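(* For every integer $n \geq 2$, $$\gamma_s(P_2 \Box P_n) = \left\lceil \frac{3n+1}{4} \right\rceil.$$
   Context: All graphs are finite, simple and undirected. A set $S\subseteq V(G)$ is dominating in $G$ if every vertex of $G$ not in $S$ has a neighbour in $S$. A set $S\subseteq V(G)$ is secure dominating in $G$ if for every vertex $v\notin S$ there is a vertex $w\in S$ adjacent to $v$ such that $(S\setminus\{w\})\cup\{v\}$ is a dominating set of $G$. The secure domination number $\gamma_s(G)$ is the minimum cardinality of a secure dominating set of $G$. $P_n$ denotes the path on $n$ vertices, and $\Box$ denotes the Cartesian product of graphs. *)

theory Defs
  imports Complex_Main "Graph_Theory.Pair_Digraph"
begin

text \<open>
  A finite simple undirected graph is a digraph without parallel arcs satisfying the
  locale \<^locale>\<open>pair_graph\<close> (finite, symmetric, loop-free): an edge \<open>uv\<close> is the pair of arcs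
  \<open>(u, v)\<close> and \<open>(v, u)\<close>. The definitions below are meant for such graphs.
\<close>

definition dominating :: "'a pair_pre_digraph \<Rightarrow> 'a set \<Rightarrow> bool" where
  "dominating G S \<longleftrightarrow>
     S \<subseteq> pverts G \<and> (\<forall>v \<in> pverts G - S. \<exists>w \<in> S. (v, w) \<in> parcs G)"

definition secure_dominating :: "'a pair_pre_digraph \<Rightarrow> 'a set \<Rightarrow> bool" where
  "secure_dominating G S \<longleftrightarrow>
     S \<subseteq> pverts G \<and>
     (\<forall>v \<in> pverts G - S. \<exists>w \<in> S. (v, w) \<in> parcs G \<and> dominating G ((S - {w}) \<union> {v}))"

definition secure_domination_number :: "'a pair_pre_digraph \<Rightarrow> nat" where
  "secure_domination_number G = Min {card S |S. secure_dominating G S}"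

definition path_graph :: "nat \<Rightarrow> nat pair_pre_digraph" where
  "path_graph n =
     \<lparr> pverts = {1..n},
       parcs = {(i, j). i \<in> {1..n} \<and> j \<in> {1..n} \<and> (j = i + 1 \<or> i = j + 1)} \<rparr>"

definition cartesian_product ::
    "'a pair_pre_digraph \<Rightarrow> 'b pair_pre_digraph \<Rightarrow> ('a \<times> 'b) pair_pre_digraph" where
  "cartesian_product G H =
     \<lparr> pverts = pverts G \<times> pverts H,
       parcs = {((u, x), (v, y)).
                  (u = v \<and> u \<in> pverts G \<and> (x, y) \<in> parcs H) \<or>
                  ((u, v) \<in> parcs G \<and> x = y \<and> x \<in> pverts H)} \<rparr>"

lemma pair_graph_path_graph: "pair_graph (path_graph n)"
proof -
  have "parcs (path_graph n) \<subseteq> {1..n} \<times> {1..n}"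
    by (auto simp: path_graph_def)
  then have "finite (parcs (path_graph n))"
    by (rule finite_subset) simp
  then show ?thesis
    by unfold_locales (auto simp: path_graph_def symmetric_def sym_def)
qed

lemma pair_graph_cartesian_product:
  assumes "pair_graph G" and "pair_graph H"
  shows "pair_graph (cartesian_product G H)"
proof -
  interpret G: pair_graph G by fact
  interpret H: pair_graph H by fact
  have "parcs (cartesian_product G H) \<subseteq> (pverts G \<times> pverts H) \<times> (pverts G \<times> pverts H)"
    by (auto simp: cartesian_product_def dest: G.wellformed' H.wellformed')
  then have "finite (parcs (cartesian_product G H))"
    by (rule finite_subset) (simp add: G.pair_finite_verts H.pair_finite_verts)
  moreover have "sym (parcs G)" "sym (parcs H)"
    using G.pair_sym_arcs H.pair_sym_arcs by (simp_all add: symmetric_def)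
  ultimately show ?thesis
    by unfold_locales
      (auto simp: cartesian_product_def symmetric_def G.pair_finite_verts H.pair_finite_verts
        intro!: symI dest: G.wellformed' H.wellformed' G.pair_no_loops H.pair_no_loops symD)
qed

text \<open>
  The minimum ranges over a finite nonempty set, since the full vertex set is always
  secure dominating; so it is attained by some secure dominating set.
\<close>

lemma secure_domination_number_attained:
  assumes "pair_graph G"
  obtains S where "secure_dominating G S" "card S = secure_domination_number G"
    "\<And>T. secure_dominating G T \<Longrightarrow> secure_domination_number G \<le> card T"
proof -
  interpret G: pair_graph G by fact
  let ?C = "{card S |S. secure_dominating G S}"
  have "?C \<subseteq> card ` Pow (pverts G)"
    by (auto simp: secure_dominating_def)
  then have fin: "finite ?C"
    by (rule finite_subset) (simp add: G.pair_finite_verts)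
  have "secure_dominating G (pverts G)"
    by (simp add: secure_dominating_def)
  then have "?C \<noteq> {}" by blast
  from Min_in[OF fin this] obtain S
    where "secure_dominating G S" "card S = secure_domination_number G"
    by (auto simp: secure_domination_number_def)
  moreover have "secure_domination_number G \<le> card T" if "secure_dominating G T" for T
    using fin that by (auto simp: secure_domination_number_def intro: Min_le)
  ultimately show thesis using that by blast
qed

end

theory Submission
  imports Defs
begin

text \<open>
  Let \<open>S\<close> be a secure dominating set of a triangle-free graph, and call a vertex outside \<open>S\<close> private
  if it has exactly one neighbour in \<open>S\<close>. If \<open>w \<in> S\<close> defends \<open>v\<close>, then no private neighbour of \<open>w\<close>
  other than \<open>v\<close> exists: it would have to be adjacent to \<open>v\<close>, creating a triangle. Hence every
  vertex of \<open>S\<close> has at most one private neighbour, and every non-private vertex outside \<open>S\<close> has a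
  neighbour in \<open>S\<close> without private neighbours. On the ladder these conditions only involve
  neighbouring columns. The lower bound follows by sweeping over the columns with a potential:
  if \<open>c\<close> vertices of \<open>S\<close> lie in the first \<open>i\<close> columns, then \<open>4 c - 3 i\<close> is at least the potential of
  the local state at column \<open>i\<close>, and in the last column the potential is at least \<open>1\<close>.
  For the upper bound, a pattern of period \<open>8\<close> with three vertices in every four columns is
  optimal for \<open>n = 4 k + 1\<close>, and each further column costs at most one vertex.
\<close>

section \<open>Private neighbours\<close>

definition private_vertex :: "'a pair_pre_digraph \<Rightarrow> 'a set \<Rightarrow> 'a \<Rightarrow> bool" where
  "private_vertex G S v \<longleftrightarrow> v \<in> pverts G - S \<and> (\<exists>!w. w \<in> S \<and> (v, w) \<in> parcs G)"

definition triangle_free :: "'a pair_pre_digraph \<Rightarrow> bool" where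
  "triangle_free G \<longleftrightarrow>
     (\<forall>u v w. (u, v) \<in> parcs G \<longrightarrow> (v, w) \<in> parcs G \<longrightarrow> (u, w) \<notin> parcs G)"

lemma pair_graph_arcs_sym:
  assumes "pair_graph G" "(u, v) \<in> parcs G"
  shows "(v, u) \<in> parcs G"
proof -
  interpret pair_graph G by fact
  show ?thesis using assms(2) pair_sym_arcs by (auto simp: symmetric_def dest: symD)
qed

lemma secure_dominating_triangle_free:
  assumes "pair_graph G" and tf: "triangle_free G" and sec: "secure_dominating G S"
    and v: "v \<in> pverts G - S"
  shows "\<exists>w\<in>S. (v, w) \<in> parcs G \<and> (\<forall>u. private_vertex G S u \<longrightarrow> (u, w) \<in> parcs G \<longrightarrow> u = v)"
proof -
  note sym = pair_graph_arcs_sym[OF assms(1)]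
  obtain w where w: "w \<in> S" "(v, w) \<in> parcs G" and dom: "dominating G ((S - {w}) \<union> {v})"
    using sec v unfolding secure_dominating_def by blast
  have "u = v" if u: "private_vertex G S u" "(u, w) \<in> parcs G" for u
  proof (rule ccontr)
    assume "u \<noteq> v"
    with u dom obtain x where x: "x \<in> (S - {w}) \<union> {v}" "(u, x) \<in> parcs G"
      unfolding dominating_def private_vertex_def by blast
    with u w have "x = v" unfolding private_vertex_def by blast
    with x u w tf sym show False unfolding triangle_free_def by blast
  qed
  with w show ?thesis by blast
qed

text \<open>A private \<open>v\<close> has \<open>w\<close> as its only neighbour in
  \<open>S\<close>, so \<open>w\<close> must be its defender, which tolerates no other private
  neighbour.\<close>

lemma private_neighbour_unique:
  assumes "pair_graph G" "triangle_free G" "secure_dominating G S"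
    and "w \<in> S" "private_vertex G S u" "(u, w) \<in> parcs G" "private_vertex G S v" "(v, w) \<in> parcs G"
  shows "u = v"
proof -
  have "v \<in> pverts G - S" using assms(7) by (simp add: private_vertex_def)
  then obtain x where "x \<in> S" "(v, x) \<in> parcs G"
    and x: "\<And>u. private_vertex G S u \<Longrightarrow> (u, x) \<in> parcs G \<Longrightarrow> u = v"
    using secure_dominating_triangle_free[OF assms(1-3)] by meson
  with assms(4,7,8) have "x = w" unfolding private_vertex_def by blast
  with x assms(5,6) show ?thesis by blast
qed

text \<open>After the swap \<open>v\<close> dominates \<open>w\<close>, and the last condition
  rescues the other neighbours of \<open>w\<close>. All remaining vertices keep a neighbour in
  \<open>S\<close>.\<close>

lemma secure_dominatingI:
  assumes "S \<subseteq> pverts G"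
    and "\<And>v. v \<in> pverts G - S \<Longrightarrow> \<exists>w\<in>S. (v, w) \<in> parcs G \<and> (w, v) \<in> parcs G \<and>
      (\<forall>u \<in> pverts G - S - {v}. (u, w) \<in> parcs G \<longrightarrow> (\<exists>x \<in> S - {w}. (u, x) \<in> parcs G))"
  shows "secure_dominating G S"
  unfolding secure_dominating_def
proof (intro conjI ballI)
  fix v assume v: "v \<in> pverts G - S"
  then obtain w where w: "w \<in> S" "(v, w) \<in> parcs G" "(w, v) \<in> parcs G"
    and priv: "\<And>u. u \<in> pverts G - S - {v} \<Longrightarrow> (u, w) \<in> parcs G \<Longrightarrow> \<exists>x \<in> S - {w}. (u, x) \<in> parcs G"
    using assms(2)[OF v] by blast
  have "\<exists>x \<in> (S - {w}) \<union> {v}. (u, x) \<in> parcs G" if u: "u \<in> pverts G - ((S - {w}) \<union> {v})" for u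
  proof (cases "u = w")
    case False
    then have "u \<in> pverts G - S - {v}" using u by blast
    moreover from this obtain y where "y \<in> S" "(u, y) \<in> parcs G" using assms(2)[of u] by blast
    ultimately show ?thesis using priv[of u] by blast
  qed (use w in blast)
  then have "dominating G ((S - {w}) \<union> {v})"
    using assms(1) v unfolding dominating_def by blast
  with w show "\<exists>w\<in>S. (v, w) \<in> parcs G \<and> dominating G ((S - {w}) \<union> {v})" by blast
qed (fact assms(1))

section \<open>The ladder\<close>

abbreviation ladder :: "nat \<Rightarrow> (nat \<times> nat) pair_pre_digraph" where
  "ladder n \<equiv> cartesian_product (path_graph 2) (path_graph n)"

lemma pair_graph_ladder: "pair_graph (ladder n)"
  by (intro pair_graph_cartesian_product pair_graph_path_graph)

lemma ladder_verts: "(r, c) \<in> pverts (ladder n) \<longleftrightarrow> (r = 1 \<or> r = 2) \<and> 1 \<le> c \<and> c \<le> n"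
  by (auto simp: cartesian_product_def path_graph_def)

lemma ladder_arcs:
  "((r, c), (s, d)) \<in> parcs (ladder n) \<longleftrightarrow>
     (r, c) \<in> pverts (ladder n) \<and> (s, d) \<in> pverts (ladder n) \<and>
     (r = s \<and> (d = c + 1 \<or> c = d + 1) \<or> r \<noteq> s \<and> c = d)"
  by (auto simp: cartesian_product_def path_graph_def)

lemma ladder_arc_parity:
  "((r, c), (s, d)) \<in> parcs (ladder n) \<Longrightarrow> even (r + c) \<longleftrightarrow> odd (s + d)"
  by (auto simp: cartesian_product_def path_graph_def)

text \<open>Arcs flip the parity of \<open>r + c\<close>, so the ladder is bipartite.\<close>

lemma triangle_free_ladder: "triangle_free (ladder n)"
  unfolding triangle_free_def split_paired_All using ladder_arc_parity by meson

section \<open>Lower bound\<close>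

text \<open>\<open>Free\<close> and \<open>Tied\<close> mark members of the set without and with a
  private neighbour; \<open>Private\<close> and \<open>Shared\<close> mark vertices outside
  it.\<close>

datatype label = Free | Tied | Private | Shared

definition in_set :: "label \<Rightarrow> bool" where
  "in_set l \<longleftrightarrow> l = Free \<or> l = Tied"

text \<open>The conditions on the labels \<open>ns\<close> of the neighbours of a vertex labelled \<open>l\<close> are split into
  those that pass to sublists of \<open>ns\<close> and those that need all neighbours.\<close>

definition feasible :: "label \<Rightarrow> label list \<Rightarrow> bool" where
  "feasible l ns = (case l of
     Free \<Rightarrow> length (filter ((=) Private) ns) = 0
   | Tied \<Rightarrow> length (filter ((=) Private) ns) \<le> 1
   | Private \<Rightarrow> length (filter in_set ns) \<le> 1
   | Shared \<Rightarrow> True)"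

definition satisfied :: "label \<Rightarrow> label list \<Rightarrow> bool" where
  "satisfied l ns = (case l of
     Private \<Rightarrow> length (filter in_set ns) \<ge> 1
   | Shared \<Rightarrow> length (filter in_set ns) \<ge> 2 \<and> Free \<in> set ns
   | _ \<Rightarrow> True)"

text \<open>What the left and vertical neighbours of a vertex leave for its right neighbour:
  a vertex of the set admits no private right neighbour and can protect non-private ones (\<open>Guard\<close>),
  still admits a private right neighbour (\<open>Open\<close>), or already has its private neighbour (\<open>Spent\<close>);
  a vertex outside needs nothing (\<open>Done\<close>), a right neighbour in the set (\<open>Wants_Set\<close>), a free one
  (\<open>Wants_Free\<close>), or has no neighbour in the set so far (\<open>Bare\<close>).\<close>

datatype state = Guard | Open | Spent | Done | Wants_Set | Wants_Free | Bare

definition state_of :: "label \<Rightarrow> label list \<Rightarrow> state" where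
  "state_of l ns = (case l of
     Free \<Rightarrow> Guard
   | Tied \<Rightarrow> if Private \<in> set ns then Spent else Open
   | Private \<Rightarrow> if filter in_set ns = [] then Bare else Done
   | Shared \<Rightarrow> if filter in_set ns = [] then Bare
       else if Free \<notin> set ns then Wants_Free
       else if length (filter in_set ns) \<ge> 2 then Done else Wants_Set)"

text \<open>Except for the dummy value \<open>-3\<close> at pairs that no column realises, the entries are
  lower bounds for \<open>4 c - 3 i\<close> over all labelled beginnings of a ladder that end in the given pair
  of states, found by dynamic programming.\<close>

primrec potential :: "state \<Rightarrow> state \<Rightarrow> int" where
  "potential Guard      = case_state   4    5    3    1    1  (-3) (-3)"
| "potential Open       = case_state   5    5    3    2  (-3)   1  (-3)"
| "potential Spent      = case_state   3    3    2    1  (-3)   0  (-3)"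
| "potential Done       = case_state   1    2    1    2    2    0  (-1)"
| "potential Wants_Set  = case_state   1  (-3) (-3)   2    1    0  (-2)"
| "potential Wants_Free = case_state (-3)   1    0    0    0  (-1) (-2)"
| "potential Bare       = case_state (-3) (-3) (-3) (-1) (-2) (-2) (-3)"

section \<open>Columns of labels and the check of the potential\<close>

type_synonym column = "label \<times> label"

fun column_potential :: "column \<Rightarrow> column \<Rightarrow> int" where
  "column_potential (a1, a2) (b1, b2) = potential (state_of b1 [a1, b2]) (state_of b2 [a2, b1])"

fun column_weight :: "column \<Rightarrow> int" where
  "column_weight (a1, a2) = of_bool (in_set a1) + of_bool (in_set a2)"

fun feasible_next :: "column \<Rightarrow> column \<Rightarrow> bool" where
  "feasible_next (a1, a2) (b1, b2) \<longleftrightarrow> feasible b1 [a1, b2] \<and> feasible b2 [a2, b1]"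

fun valid_column :: "column \<Rightarrow> column \<Rightarrow> column \<Rightarrow> bool" where
  "valid_column (a1, a2) (b1, b2) (c1, c2) \<longleftrightarrow>
     feasible b1 [a1, b2, c1] \<and> feasible b2 [a2, b1, c2] \<and>
     satisfied b1 [a1, b2, c1] \<and> satisfied b2 [a2, b1, c2]"

definition columns :: "column list" where
  "columns = List.product [Free, Tied, Private, Shared] [Free, Tied, Private, Shared]"

lemma in_columns: "a \<in> set columns"
proof -
  obtain l m where a: "a = (l, m)" by (cases a)
  show ?thesis unfolding a by (cases l; cases m; simp add: columns_def)
qed

text \<open>The checks are named constants because the simplifier evaluates a \<open>\<lambda>\<close>-abstraction
  under its binder, where the case distinctions on a variable column explode.\<close>

definition step_from :: "column \<Rightarrow> column \<Rightarrow> column \<Rightarrow> bool" where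
  "step_from b c a = (if valid_column a b c
     then column_potential b c \<le> column_potential a b + 4 * column_weight c - 3 else True)"

definition steps_to :: "column \<Rightarrow> column \<Rightarrow> bool" where
  "steps_to b c = (if feasible_next b c then list_all (step_from b c) columns else True)"

definition steps_at :: "column \<Rightarrow> bool" where
  "steps_at b = list_all (steps_to b) columns"

text \<open>A finite check over the 16^3 triples of columns, done by evaluation.\<close>

lemma potential_step:
  assumes "valid_column a b c" "feasible_next b c"
  shows "column_potential b c \<le> column_potential a b + 4 * column_weight c - 3"
proof -
  have "list_all steps_at columns" by code_simp
  then have "steps_to b c" using in_columns unfolding list_all_iff steps_at_def by blast
  then have "step_from b c a" using assms(2) in_columns by (simp add: list_all_iff steps_to_def)
  then show ?thesis using assms(1) by (simp add: step_from_def)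
qed

lemmas label_simps = feasible_def satisfied_def state_of_def in_set_def

text \<open>Start of the sweep: a dummy column 0 outside the graph lies to the left of column
  1.\<close>

lemma potential_first: "column_potential (Shared, Shared) a \<le> 4 * column_weight a - 3"
proof -
  obtain l m where a: "a = (l, m)" by (cases a)
  show ?thesis unfolding a by (cases l; cases m; simp add: label_simps)
qed

lemma potential_last:
  assumes "valid_column a b (Shared, Shared)"
  shows "1 \<le> column_potential a b"
proof -
  obtain a1 a2 b1 b2 where ab: "a = (a1, a2)" "b = (b1, b2)" by (cases a; cases b)
  show ?thesis using assms unfolding ab
    by (cases b1; cases b2; cases a1; cases a2; simp add: label_simps)
qed

lemma feasible_append: "feasible l (xs @ ys) \<Longrightarrow> feasible l xs"
  by (auto simp: feasible_def split: label.splits)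

lemma feasible_next_if_valid: "valid_column a b c \<Longrightarrow> feasible_next a b"
  by (cases a; cases b; cases c)
    (auto intro: feasible_append[of _ "[x, y]" "[z]" for x y z, simplified])

text \<open>Positions outside the graph are labelled \<open>Shared\<close>, the label that never counts
  in the neighbourhood of another vertex.\<close>

definition label_of :: "'a pair_pre_digraph \<Rightarrow> 'a set \<Rightarrow> 'a \<Rightarrow> label" where
  "label_of G S v =
     (if v \<in> S then if \<exists>u. private_vertex G S u \<and> (u, v) \<in> parcs G then Tied else Free
      else if private_vertex G S v then Private else Shared)"

lemma in_set_label_of: "in_set (label_of G S v) \<longleftrightarrow> v \<in> S"
  by (auto simp: label_of_def in_set_def)

lemma label_of_Private: "label_of G S v = Private \<longleftrightarrow> private_vertex G S v"
  by (auto simp: label_of_def private_vertex_def)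

section \<open>Local conditions on the labels of a secure dominating set\<close>

lemma length_filter_map_distinct:
  "distinct vs \<Longrightarrow> length (filter P (map f vs)) = card {v \<in> set vs. P (f v)}"
  by (simp add: filter_map distinct_length_filter Int_def conj_commute o_def)

text \<open>\<open>vs\<close> may contain positions outside the graph: they are labelled
  \<open>Shared\<close> and drop out of all counts. This handles the ends of the ladder.\<close>

lemma label_of_conditions:
  assumes G: "pair_graph G" and tf: "triangle_free G" and sec: "secure_dominating G S"
    and v: "v \<in> pverts G" and vs: "distinct vs"
    and nbrs: "\<And>w. w \<in> pverts G \<Longrightarrow> (v, w) \<in> parcs G \<longleftrightarrow> w \<in> set vs"
  shows "feasible (label_of G S v) (map (label_of G S) vs)"
    and "satisfied (label_of G S v) (map (label_of G S) vs)"
proof -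
  have sym: "(y, x) \<in> parcs G \<longleftrightarrow> (x, y) \<in> parcs G" for x y
    using pair_graph_arcs_sym[OF G] by blast
  have finite_verts: "finite (pverts G)"
  proof -
    interpret pair_graph G by (fact G)
    show ?thesis by (fact pair_finite_verts)
  qed
  have S: "S \<subseteq> pverts G" using sec by (simp add: secure_dominating_def)
  have members: "length (filter in_set (map (label_of G S) vs)) = card {w \<in> S. (v, w) \<in> parcs G}"
    unfolding length_filter_map_distinct[OF vs] in_set_label_of
    using nbrs S by (intro arg_cong[of _ _ card]) blast
  have privates: "length (filter ((=) Private) (map (label_of G S) vs))
      = card {u. private_vertex G S u \<and> (u, v) \<in> parcs G}"
    unfolding length_filter_map_distinct[OF vs] eq_commute[of Private] label_of_Private
    using nbrs by (intro arg_cong[of _ _ card]) (auto simp: private_vertex_def sym)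
  have fin: "finite {w \<in> S. (v, w) \<in> parcs G}"
    by (rule finite_subset[OF _ finite_verts]) (use S in blast)
  have one: "card {w \<in> S. (v, w) \<in> parcs G} = 1 \<longleftrightarrow> (\<exists>!w. w \<in> S \<and> (v, w) \<in> parcs G)"
  proof -
    have "(\<exists>x. \<forall>w. P w \<longleftrightarrow> w = x) \<longleftrightarrow> (\<exists>!w. P w)" for P :: "'a \<Rightarrow> bool"
      unfolding Ex1_def by (intro arg_cong[of _ _ Ex] ext) auto
    then show ?thesis by (simp add: card_1_singleton_iff set_eq_iff)
  qed
  have fin_privates: "finite {u. private_vertex G S u \<and> (u, v) \<in> parcs G}"
    by (rule finite_subset[OF _ finite_verts]) (auto simp: private_vertex_def)
  have unique: "card {u. private_vertex G S u \<and> (u, v) \<in> parcs G} \<le> 1" if "v \<in> S"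
    unfolding One_nat_def card_le_Suc0_iff_eq[OF fin_privates]
    by (intro ballI private_neighbour_unique[OF G tf sec that]) simp_all
  have defender: "\<exists>w\<in>S. (v, w) \<in> parcs G \<and> (\<forall>u. private_vertex G S u \<longrightarrow> (u, w) \<in> parcs G \<longrightarrow> u = v)"
    if "v \<notin> S"
    using secure_dominating_triangle_free[OF G tf sec] v that by simp
  have pos: "card {w \<in> S. (v, w) \<in> parcs G} \<noteq> 0" if "v \<notin> S"
    unfolding card_0_eq[OF fin] using defender[OF that] by blast
  show "feasible (label_of G S v) (map (label_of G S) vs)"
  proof (cases "label_of G S v")
    case Free
    then have "card {u. private_vertex G S u \<and> (u, v) \<in> parcs G} = 0"
      unfolding card_0_eq[OF fin_privates] by (auto simp: label_of_def split: if_splits)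
    then show ?thesis using Free unfolding feasible_def privates by simp
  next
    case Tied
    then show ?thesis using unique unfolding feasible_def privates
      by (simp add: label_of_def split: if_splits)
  next
    case Private
    then have "\<exists>!w. w \<in> S \<and> (v, w) \<in> parcs G"
      by (simp add: label_of_Private private_vertex_def)
    then show ?thesis using Private unfolding feasible_def members one[symmetric] by simp
  qed (simp add: feasible_def)
  \<comment> \<open>The defender has no private neighbour except possibly \<open>v\<close>, and
    \<open>v\<close> is not private.\<close>
  have "Free \<in> label_of G S ` set vs" if v_out: "v \<notin> S" "\<not> private_vertex G S v"
  proof -
    obtain w where w: "w \<in> S" "(v, w) \<in> parcs G"
      "\<And>u. private_vertex G S u \<Longrightarrow> (u, w) \<in> parcs G \<Longrightarrow> u = v"
      using defender[OF v_out(1)] by blast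
    then have "label_of G S w = Free" using v_out by (auto simp: label_of_def)
    moreover have "w \<in> set vs" using w nbrs S by blast
    ultimately show ?thesis by (metis imageI)
  qed
  moreover have "card {w \<in> S. (v, w) \<in> parcs G} \<ge> 2" if "v \<notin> S" "\<not> private_vertex G S v"
  proof -
    have "card {w \<in> S. (v, w) \<in> parcs G} \<noteq> 1"
      unfolding one using that v by (simp add: private_vertex_def)
    with pos[OF that(1)] show ?thesis by linarith
  qed
  ultimately show "satisfied (label_of G S v) (map (label_of G S) vs)"
    unfolding satisfied_def members using pos
    by (cases "label_of G S v") (auto simp: label_of_def Suc_le_eq split: if_splits)
qed

lemma secure_dominating_ladder_ge:
  assumes sec: "secure_dominating (ladder n) S" and n: "n \<ge> 1"
  shows "3 * n + 1 \<le> 4 * card S"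
proof -
  define L where "L = label_of (ladder n) S"
  define col where "col c = (L (1, c), L (2, c))" for c
  have verts: "S \<subseteq> pverts (ladder n)" using sec by (simp add: secure_dominating_def)
  then have S: "S \<subseteq> {1..2} \<times> {1..n}" by (simp add: cartesian_product_def path_graph_def)
  have "L v = Shared" if "v \<notin> pverts (ladder n)" for v
    using that verts unfolding L_def label_of_def private_vertex_def by auto
  then have out: "col c = (Shared, Shared)" if "c < 1 \<or> c > n" for c
    using that by (auto simp: col_def ladder_verts)
  have cond: "feasible (L (r, c)) (map L [(r, c - 1), (3 - r, c), (r, c + 1)])"
    "satisfied (L (r, c)) (map L [(r, c - 1), (3 - r, c), (r, c + 1)])"
    if rc: "r = 1 \<or> r = 2" "1 \<le> c" "c \<le> n" for r c
  proof -
    \<comment> \<open>\<open>3 - r\<close> swaps the rows; columns \<open>c - 1\<close> and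
      \<open>c + 1\<close> may lie outside the graph.\<close>
    let ?vs = "[(r, c - 1), (3 - r, c), (r, c + 1)]"
    have v: "(r, c) \<in> pverts (ladder n)" using rc by (simp add: ladder_verts)
    have vs: "distinct ?vs" using rc by (elim disjE) simp_all
    have nbrs: "((r, c), w) \<in> parcs (ladder n) \<longleftrightarrow> w \<in> set ?vs" if w: "w \<in> pverts (ladder n)" for w
    proof -
      obtain s d where sd: "w = (s, d)" by (cases w)
      have "s = 1 \<or> s = 2" using w by (simp add: sd ladder_verts)
      with rc(1) have "r \<noteq> s \<longleftrightarrow> s = 3 - r" by presburger
      moreover have "c = d + 1 \<longleftrightarrow> d = c - 1" using rc(2) by presburger
      ultimately show ?thesis using v w by (simp add: sd ladder_arcs del: One_nat_def) blast
    qed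
    note * = label_of_conditions[OF pair_graph_ladder triangle_free_ladder sec v vs nbrs]
    show "feasible (L (r, c)) (map L ?vs)" "satisfied (L (r, c)) (map L ?vs)"
      unfolding L_def using * by blast+
  qed
  have valid: "valid_column (col (c - 1)) (col c) (col (c + 1))" if "1 \<le> c" "c \<le> n" for c
    using cond[of 1 c] cond[of 2 c] that by (simp add: col_def)
  have weight: "column_weight (col c) = int (card {v \<in> S. snd v = c})" for c
  proof -
    have "{v \<in> S. snd v = c} = (if (1, c) \<in> S then {(1, c)} else {}) \<union> (if (2, c) \<in> S then {(2, c)} else {})"
      using S by (auto simp: le_Suc_eq numeral_2_eq_2)
    then show ?thesis by (simp add: col_def L_def in_set_label_of)
  qed
  have bound: "column_potential (col (i - 1)) (col i)
      \<le> 4 * (\<Sum>c = 1..i. column_weight (col c)) - 3 * int i" if "1 \<le> i" "i \<le> n" for i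
    using that
  proof (induction i rule: dec_induct)
    case base
    then show ?case using potential_first[of "col 1"] out[of 0] by simp
  next
    case (step i)
    then have "column_potential (col i) (col (i + 1))
        \<le> column_potential (col (i - 1)) (col i) + 4 * column_weight (col (i + 1)) - 3"
      using potential_step valid[of i] feasible_next_if_valid[OF valid[of "i + 1"]] by simp
    with step show ?case by simp
  qed
  have "1 \<le> column_potential (col (n - 1)) (col n)"
    using potential_last valid[of n] n out[of "n + 1"] by simp
  with bound[of n] n have "3 * int n + 1 \<le> 4 * (\<Sum>c = 1..n. column_weight (col c))"
    by simp
  also have "(\<Sum>c = 1..n. column_weight (col c)) = int (card S)"
  proof -
    have "finite S" using S by (rule finite_subset) simp
    moreover have "S = (\<Union>c\<in>{1..n}. {v \<in> S. snd v = c})" using S by auto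
    ultimately have "card S = (\<Sum>c = 1..n. card {v \<in> S. snd v = c})"
      by (subst \<open>S = _\<close>, subst card_UN_disjoint) auto
    then show ?thesis by (simp add: weight)
  qed
  finally show ?thesis by simp
qed

section \<open>Upper bound\<close>

text \<open>The new vertex dominates its column and defends its rung partner; old vertices keep
  their defenders.\<close>

lemma secure_dominating_ladder_Suc:
  assumes sec: "secure_dominating (ladder n) S"
  shows "secure_dominating (ladder (Suc n)) (insert (1, Suc n) S)"
proof -
  have S: "S \<subseteq> pverts (ladder n)" using sec by (simp add: secure_dominating_def)
  have verts: "v \<in> pverts (ladder (Suc n)) \<longleftrightarrow>
      v \<in> pverts (ladder n) \<or> v = (1, Suc n) \<or> v = (2, Suc n)" for v
    by (cases v) (auto simp: ladder_verts)
  have arcs: "e \<in> parcs (ladder n) \<Longrightarrow> e \<in> parcs (ladder (Suc n))" for e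
    by (cases e) (auto simp: cartesian_product_def path_graph_def)
  have rung: "((2, Suc n), (1, Suc n)) \<in> parcs (ladder (Suc n))"
    by (simp add: ladder_arcs ladder_verts)
  have notin: "(r, Suc n) \<notin> pverts (ladder n)" for r by (simp add: ladder_verts)
  \<comment> \<open>The second alternative serves the swap along the new rung, after which
    \<open>(1, Suc n)\<close> itself needs a neighbour.\<close>
  have extend: "dominating (ladder (Suc n)) T'"
    if "dominating (ladder n) T" "T \<subseteq> T'" "T' \<subseteq> pverts (ladder (Suc n))"
      "(1, Suc n) \<in> T' \<or> (2, Suc n) \<in> T' \<and> (\<exists>w\<in>T'. ((1, Suc n), w) \<in> parcs (ladder (Suc n)))" for T T'
    using that verts arcs rung unfolding dominating_def by blast
  show ?thesis
    unfolding secure_dominating_def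
  proof (intro conjI ballI)
    fix v assume v: "v \<in> pverts (ladder (Suc n)) - insert (1, Suc n) S"
    show "\<exists>w\<in>insert (1, Suc n) S. (v, w) \<in> parcs (ladder (Suc n)) \<and>
        dominating (ladder (Suc n)) (insert (1, Suc n) S - {w} \<union> {v})"
    proof (cases "v = (2, Suc n)")
      case True
      have "dominating (ladder n) S"
        using sec unfolding secure_dominating_def dominating_def by blast
      then have "dominating (ladder (Suc n)) (insert (1, Suc n) S - {(1, Suc n)} \<union> {v})"
        using S notin True verts
        by (intro extend[of S])
          (auto simp: ladder_arcs ladder_verts)
      then show ?thesis using True rung by blast
    next
      case False
      with v verts have "v \<in> pverts (ladder n) - S" by blast
      then obtain w where w: "w \<in> S" "(v, w) \<in> parcs (ladder n)"
        "dominating (ladder n) (S - {w} \<union> {v})"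
        using sec unfolding secure_dominating_def by blast
      moreover have "dominating (ladder (Suc n)) (insert (1, Suc n) S - {w} \<union> {v})"
        using w(1) S notin verts v by (intro extend[OF w(3)]) blast+
      ultimately show ?thesis using arcs by blast
    qed
  qed (use S verts in blast)
qed

text \<open>The pattern, in its first nine columns: \<open># . . # . # . . #\<close> over \<open>. # . . # . . # .\<close>\<close>

definition pattern :: "nat \<Rightarrow> (nat \<times> nat) set" where
  "pattern n = {(r, c) \<in> pverts (ladder n).
     c mod 8 \<in> (if r = 1 then {1, 4, 6} else {0, 2, 5})}"

text \<open>Columns congruent to 3 modulo 4 are empty; every other column holds one pattern
  vertex.\<close>

lemma card_pattern: "card (pattern (4 * k + 1)) \<le> 3 * k + 1"
proof -
  have "pattern n \<subseteq> (\<lambda>c. (if c mod 8 \<in> {1, 4, 6} then 1 else 2, c)) ` {c \<in> {1..n}. c mod 4 \<noteq> 3}" for n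
  proof
    fix v assume "v \<in> pattern n"
    moreover obtain r c where rc: "v = (r, c)" by (cases v)
    moreover have "c mod 8 mod 4 = c mod 4" by (simp add: mod_mod_cancel)
    ultimately show "v \<in> (\<lambda>c. (if c mod 8 \<in> {1, 4, 6} then 1 else 2, c)) ` {c \<in> {1..n}. c mod 4 \<noteq> 3}"
      by (intro image_eqI[of _ _ c]) (auto simp: pattern_def ladder_verts split: if_splits)
  qed
  then have "card (pattern (4 * k + 1)) \<le> card {c \<in> {1..4 * k + 1}. c mod 4 \<noteq> 3}"
    by (intro surj_card_le) simp_all
  also have "card {c \<in> {1..4 * k + 1}. c mod 4 \<noteq> 3} = 3 * k + 1"
  proof (induction k)
    case 0
    have "{c \<in> {1..1}. c mod 4 \<noteq> 3} = {1::nat}" by auto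
    then show ?case by simp
  next
    case (Suc k)
    have "{c \<in> {1..4 * Suc k + 1}. c mod 4 \<noteq> 3} =
        {c \<in> {1..4 * k + 1}. c mod 4 \<noteq> 3} \<union> {4 * k + 2, 4 * k + 4, 4 * k + 5}"
      by (auto; presburger)
    also have "card \<dots> = 3 * k + 1 + 3" by (subst card_Un_disjoint) (auto simp: Suc[simplified])
    finally show ?case by simp
  qed
  finally show ?thesis .
qed

lemma in_pattern:
  "(r, c) \<in> pattern n \<longleftrightarrow> (r, c) \<in> pverts (ladder n) \<and>
     (if r = 1 then c mod 8 = 1 \<or> c mod 8 = 4 \<or> c mod 8 = 6
      else c mod 8 = 0 \<or> c mod 8 = 2 \<or> c mod 8 = 5)"
  by (simp add: pattern_def)

lemma ladder_neighbour_in: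
  assumes "S \<subseteq> pverts (ladder n)" "(r, c) \<in> pverts (ladder n)"
    and "(3 - r, c) \<in> S - {w} \<or> (r, c + 1) \<in> S - {w} \<or> (r, c - 1) \<in> S - {w}"
  shows "\<exists>x \<in> S - {w}. ((r, c), x) \<in> parcs (ladder n)"
proof -
  have "((r, c), x) \<in> parcs (ladder n)"
    if "x = (3 - r, c) \<or> x = (r, c + 1) \<or> x = (r, c - 1)" "x \<in> S" for x
  proof -
    have "x \<in> pverts (ladder n)" using that assms(1) by blast
    moreover have "r = 1 \<or> r = 2" "1 \<le> c" using assms(2) by (simp_all add: ladder_verts)
    ultimately show ?thesis using that(1) assms(2) by (elim disjE) (simp_all add: ladder_arcs)
  qed
  with assms(3) show ?thesis by blast
qed

lemma secure_dominating_pattern: "secure_dominating (ladder (4 * k + 1)) (pattern (4 * k + 1))"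
proof (rule secure_dominatingI)
  let ?n = "4 * k + 1"
  let ?G = "ladder ?n" and ?S = "pattern ?n"
  show S: "?S \<subseteq> pverts ?G" by (auto simp: pattern_def)
  fix v assume v: "v \<in> pverts ?G - ?S"
  obtain r c where rc: "v = (r, c)" by (cases v)
  define q t where "q = (c - 1) div 8" and "t = (c - 1) mod 8 + 1"
  have "1 \<le> c" using v by (simp add: rc ladder_verts)
  then have c: "c = 8 * q + t" unfolding q_def t_def using mult_div_mod_eq[of 8 "c - 1"] by linarith
  have "1 \<le> t" "t \<le> 8" by (simp_all add: t_def Suc_le_eq)
  then have t: "t = 1 \<or> t = 2 \<or> t = 3 \<or> t = 4 \<or> t = 5 \<or> t = 6 \<or> t = 7 \<or> t = 8" by presburger
  have le: "c \<le> ?n" using v by (simp add: rc ladder_verts)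
  \<comment> \<open>A last column congruent to 1 modulo 4 leaves room for the pattern vertices
    needed to the right of \<open>c\<close>.\<close>
  then have room: "t = 2 \<or> t = 6 \<Longrightarrow> c + 3 \<le> ?n" "t = 3 \<or> t = 7 \<Longrightarrow> c + 2 \<le> ?n"
    "t = 4 \<or> t = 8 \<Longrightarrow> c + 1 \<le> ?n"
    unfolding c by presburger+
  \<comment> \<open>The defender is the rung partner of \<open>v\<close> if \<open>t\<close> is 1 or
    5, otherwise a pattern vertex next to \<open>v\<close> in its row.\<close>
  define rw cw :: nat where "rw =
    (if r = 1 then if t = 5 then 2 else 1 else if t = 1 then 1 else 2)" and "cw =
    (if t = 1 \<or> t = 5 then c
     else if r = 1 \<and> (t = 2 \<or> t = 7) \<or> r = 2 \<and> (t = 3 \<or> t = 6) then c - 1 else c + 1)"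
  define w :: "nat \<times> nat" where w: "w = (rw, cw)"
  have r: "r = 1 \<or> r = 2" using v by (simp add: rc ladder_verts)
  have mods: "Suc (8 * q) mod 8 = 1" "Suc (Suc (8 * q)) mod 8 = 2"
    "Suc (Suc (Suc (8 * q))) mod 8 = 3"
    by presburger+
  have v_out: "(r, c) \<notin> ?S" using v by (simp add: rc)
  have "w \<in> ?S \<and> (v, w) \<in> parcs ?G \<and> (w, v) \<in> parcs ?G"
    using t r
    apply (elim disjE)
    using c v_out le room
    by (simp_all add: w rc rw_def cw_def in_pattern ladder_arcs ladder_verts mods)
  moreover have "\<exists>x \<in> ?S - {w}. (u, x) \<in> parcs ?G"
    if u: "u \<in> pverts ?G - ?S - {v}" "(u, w) \<in> parcs ?G" for u
  proof -
    obtain s d where sd: "u = (s, d)" by (cases u)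
    have s: "s = 1 \<or> s = 2" and d: "1 \<le> d" "d \<le> ?n"
      using u by (simp_all add: sd ladder_verts)
    have u_out: "(s, d) \<notin> ?S" "(s, d) \<noteq> (r, c)" using u by (simp_all add: sd rc)
    have adj: "s = rw \<and> d = cw + 1 \<or> s = rw \<and> d = cw - 1 \<or> s \<noteq> rw \<and> d = cw"
      using u(2) by (auto simp: sd w ladder_arcs)
    have "(3 - s, d) \<in> ?S - {w} \<or> (s, d + 1) \<in> ?S - {w} \<or> (s, d - 1) \<in> ?S - {w}"
      using t r s adj
      apply (elim disjE conjE)
      using c v_out u_out d rw_def cw_def le
      apply (simp_all add: w in_pattern ladder_verts mods split: if_splits)
      apply presburger+
      done
    then show ?thesis using S u unfolding sd by (intro ladder_neighbour_in) auto
  qed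
  ultimately show "\<exists>w\<in>?S. (v, w) \<in> parcs ?G \<and> (w, v) \<in> parcs ?G \<and>
      (\<forall>u \<in> pverts ?G - ?S - {v}. (u, w) \<in> parcs ?G \<longrightarrow> (\<exists>x \<in> ?S - {w}. (u, x) \<in> parcs ?G))"
    by blast
qed

lemma secure_domination_number_ladder_le: "secure_domination_number (ladder (4 * k + 1 + j)) \<le> 3 * k + 1 + j"
proof -
  have "\<exists>S. secure_dominating (ladder (4 * k + 1 + j)) S \<and> card S \<le> 3 * k + 1 + j"
  proof (induction j)
    case 0
    show ?case using secure_dominating_pattern[of k] card_pattern[of k] by auto
  next
    case (Suc j)
    then obtain S where "secure_dominating (ladder (4 * k + 1 + j)) S" "card S \<le> 3 * k + 1 + j" by blast
    then show ?case
      using secure_dominating_ladder_Suc[of "4 * k + 1 + j" S]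
      by (intro exI[of _ "insert (1, Suc (4 * k + 1 + j)) S"]) (simp add: card_insert_le_m1)
  qed
  then show ?thesis
    using secure_domination_number_attained[OF pair_graph_ladder] by (meson le_trans)
qed

theorem theorem10:
  fixes n :: nat
  assumes "n \<ge> 2"
  shows "int (secure_domination_number (cartesian_product (path_graph 2) (path_graph n)))
           = \<lceil>(3 * real n + 1) / 4\<rceil>"
proof -
  let ?g = "secure_domination_number (ladder n)"
  obtain S where "secure_dominating (ladder n) S" "card S = ?g"
    using secure_domination_number_attained[OF pair_graph_ladder] by blast
  with secure_dominating_ladder_ge assms have lower: "3 * n + 1 \<le> 4 * ?g" by fastforce
  \<comment> \<open>\<open>4 * (3 * k + 1 + j)\<close> exceeds \<open>3 * n + 1\<close> by exactly
    \<open>j\<close>, hence by less than 4.\<close>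
  define k j where "k = (n - 1) div 4" and "j = (n - 1) mod 4"
  have n: "n = 4 * k + 1 + j" and "j < 4" using assms by (auto simp: k_def j_def)
  with secure_domination_number_ladder_le[of k j] have "4 * ?g < 3 * n + 1 + 4" by simp
  with lower show ?thesis by (intro ceiling_unique[symmetric]) auto
qed

end
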